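(* Let $X$ be a real normed linear space, $\Omega\subseteq X$ a nonempty closed set, $v\in X$ nonzero, and $T(x):=\inf\{t\ge 0\mid x+tv\in\Omega\}$. Let $\bar x\in\operatorname{dom}T\setminus\Omega$ and let $\tilde x:=\bar x+T(\bar x)v$. Then $$\partial^-T(\bar x)\subseteq\{x^*\in X^*\mid\langle x^*,-v\rangle=1\}\cap N^-(\tilde x;\Omega).$$ The opposite inclusion holds if $T$ is lower calm at $\bar x$.
   Context: $T$ takes values in $[0,\infty]$ with $\inf\emptyset=\infty$, and $\operatorname{dom}T:=\{x\mid T(x)<\infty\}$; for $x\in\operatorname{dom}T$ the point $x+T(x)v$ lies in $\Omega$. $X^*$ is the topological dual of $X$. For $\psi:X\to(-\infty,\infty]$ and $\bar x$ with $\psi(\bar x)<\infty$, the Dini-Hadamard directional derivative in direction $u$ is $\psi'(\bar x;u):=\liminf_{t\to0^+,\,w\to u}\frac{\psi(\bar x+tw)-\psi(\bar x)}{t}$, and the Dini-Hadamard subdifferential is $\partial^-\psi(\bar x):=\{x^*\in X^*\mid\langle x^*,h\rangle\le\psi'(\bar x;h)\ \forall h\in X\}$. For $y\in\Omega$, the Bouligand contingent cone $K(y;\Omega)$ is the set of $d\in X$ such that there exist sequences $t_k\to0^+$ (with $t_k>0$) and $d_k\to d$ with $y+t_kd_k\in\Omega$ for every $k$, and the Dini-Hadamard normal cone is $N^-(y;\Omega):=\{x^*\in X^*\mid\langle x^*,d\rangle\le0\ \forall d\in K(y;\Omega)\}$. A function $\psi$ is lower calm at $\bar x\in\operatorname{dom}\psi$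 if there exist $\ell\in\mathbb R$ and $\delta>0$ such that $\psi(x)-\psi(\bar x)\ge\ell\|x-\bar x\|$ for all $x$ with $\|x-\bar x\|\le\delta$. *)

theory Defs
  imports "HOL-Analysis.Analysis"
begin

text \<open>The topological dual of \<open>X\<close> is rendered by the type \<open>'a \<Rightarrow>\<^sub>L real\<close> of bounded linear
  functionals. Functions with values in \<open>(-\<infinity>, \<infinity>]\<close> are rendered as \<open>ereal\<close>-valued functions;
  all notions at a point \<open>x\<close> are meant for \<open>\<psi> > -\<infinity>\<close> and \<open>x\<close> in the effective domain.\<close>

definition effective_domain :: "('a \<Rightarrow> ereal) \<Rightarrow> 'a set" where
  "effective_domain \<psi> = {x. \<psi> x < \<infinity>}"

text \<open>The infimum is taken in \<open>ereal\<close>, so that the infimum of the empty set is \<open>\<infinity>\<close>.\<close>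

definition minimal_time :: "'a::real_normed_vector set \<Rightarrow> 'a \<Rightarrow> 'a \<Rightarrow> ereal" where
  "minimal_time \<Omega> v x = Inf (ereal ` {t. 0 \<le> t \<and> x + t *\<^sub>R v \<in> \<Omega>})"

text \<open>The filter is \<open>nhds u\<close> rather than \<open>at u\<close>: the value \<open>w = u\<close> is admitted in the lower limit.\<close>

definition dini_hadamard_deriv :: "('a::real_normed_vector \<Rightarrow> ereal) \<Rightarrow> 'a \<Rightarrow> 'a \<Rightarrow> ereal" where
  "dini_hadamard_deriv \<psi> x u =
     Liminf (at_right (0::real) \<times>\<^sub>F nhds u) (\<lambda>(t, w). (\<psi> (x + t *\<^sub>R w) - \<psi> x) / ereal t)"

definition dini_hadamard_subdiff ::
    "('a::real_normed_vector \<Rightarrow> ereal) \<Rightarrow> 'a \<Rightarrow> ('a \<Rightarrow>\<^sub>L real) set" where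
  "dini_hadamard_subdiff \<psi> x =
     {x'. \<forall>h. ereal (blinfun_apply x' h) \<le> dini_hadamard_deriv \<psi> x h}"

definition contingent_cone :: "'a::real_normed_vector \<Rightarrow> 'a set \<Rightarrow> 'a set" where
  "contingent_cone y \<Omega> =
     {d. \<exists>(t :: nat \<Rightarrow> real) (e :: nat \<Rightarrow> 'a).
           (\<forall>k. 0 < t k) \<and> t \<longlonglongrightarrow> 0 \<and> e \<longlonglongrightarrow> d \<and> (\<forall>k. y + t k *\<^sub>R e k \<in> \<Omega>)}"

definition dini_hadamard_normal_cone ::
    "'a::real_normed_vector \<Rightarrow> 'a set \<Rightarrow> ('a \<Rightarrow>\<^sub>L real) set" where
  "dini_hadamard_normal_cone y \<Omega> =
     {x'. \<forall>d \<in> contingent_cone y \<Omega>. blinfun_apply x' d \<le> 0}"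

definition lower_calm_at :: "('a::real_normed_vector \<Rightarrow> ereal) \<Rightarrow> 'a \<Rightarrow> bool" where
  "lower_calm_at \<psi> xb \<longleftrightarrow>
     xb \<in> effective_domain \<psi> \<and>
     (\<exists>(l::real) \<delta>. 0 < \<delta> \<and>
        (\<forall>x. norm (x - xb) \<le> \<delta> \<longrightarrow> ereal (l * norm (x - xb)) \<le> \<psi> x - \<psi> xb))"

end

theory Submission
  imports Defs
begin

text \<open>For the first inclusion, move from \<open>xb\<close> along \<open>v\<close>, along \<open>-v\<close>, and along a contingent
  direction \<open>d\<close> of \<open>\<Omega>\<close> at \<open>xt\<close>; the difference quotients of \<open>T\<close> are at most \<open>-1\<close>, \<open>1\<close> and \<open>0\<close>.
  For the converse, take \<open>t\<^sub>k \<rightarrow> 0\<close> and \<open>w\<^sub>k \<rightarrow> h\<close> whose difference quotients \<open>s\<^sub>k\<close> stay below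
  \<open>c < \<langle>x', h\<rangle>\<close>. Lower calmness bounds \<open>s\<^sub>k\<close> from below, so \<open>s\<^sub>k \<rightarrow> s \<le> c\<close> along a subsequence.
  As the infimum defining \<open>T\<close> is attained, \<open>xt + t\<^sub>k (w\<^sub>k + s\<^sub>k v) \<in> \<Omega>\<close>; hence \<open>h + s v\<close> is a
  contingent direction and \<open>\<langle>x', h\<rangle> - s = \<langle>x', h + s v\<rangle> \<le> 0\<close>, contradicting \<open>s \<le> c\<close>.\<close>

lemma minimal_time_le:
  assumes "0 \<le> t" "x + t *\<^sub>R v \<in> \<Omega>"
  shows "minimal_time \<Omega> v x \<le> ereal t"
  unfolding minimal_time_def using assms by (intro Inf_lower) auto

text \<open>Finiteness makes the set of admissible times nonempty; it is bounded below by 0, and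
  closed as the part in \<open>{0..}\<close> of a preimage of \<open>\<Omega>\<close> under a
  continuous map. Hence it contains its infimum.\<close>

lemma minimal_time_attained:
  fixes \<Omega> :: "'a::real_normed_vector set"
  assumes "closed \<Omega>" "minimal_time \<Omega> v x < \<infinity>"
  obtains r where "0 \<le> r" "minimal_time \<Omega> v x = ereal r" "x + r *\<^sub>R v \<in> \<Omega>"
proof -
  let ?A = "{t. 0 \<le> t \<and> x + t *\<^sub>R v \<in> \<Omega>}"
  have ne: "?A \<noteq> {}"
    using assms(2) unfolding minimal_time_def by (metis Inf_empty image_empty less_irrefl top_ereal_def)
  have bdd: "bdd_below ?A"
    by (rule bdd_belowI[of _ 0]) auto
  have "closed ((\<lambda>t. x + t *\<^sub>R v) -` \<Omega>)"
    by (intro closed_vimage assms continuous_intros)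
  moreover have "?A = {0..} \<inter> (\<lambda>t. x + t *\<^sub>R v) -` \<Omega>"
    by auto
  ultimately have "closed ?A"
    by (simp add: closed_Int)
  then have mem: "Inf ?A \<in> ?A"
    using ne bdd by (rule closed_contains_Inf[rotated 2])
  have "minimal_time \<Omega> v x = ereal (Inf ?A)"
  proof (rule antisym)
    show "minimal_time \<Omega> v x \<le> ereal (Inf ?A)"
      using mem by (intro minimal_time_le) auto
    show "ereal (Inf ?A) \<le> minimal_time \<Omega> v x"
      unfolding minimal_time_def
      by (intro Inf_greatest) (auto intro: cInf_lower[OF _ bdd])
  qed
  with mem that show thesis by auto
qed

lemma Liminf_le_along_sequence:
  fixes f :: "'a \<Rightarrow> ereal"
  assumes "filterlim a F sequentially" "\<forall>\<^sub>F n in sequentially. f (a n) \<le> c"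
  shows "Liminf F f \<le> c"
proof (rule ccontr)
  assume "\<not> Liminf F f \<le> c"
  then have "\<forall>\<^sub>F y in F. c < f y"
    by (intro less_LiminfD) auto
  then have "\<forall>\<^sub>F n in sequentially. c < f (a n)"
    using assms(1) by (rule eventually_compose_filterlim)
  with assms(2) have "\<forall>\<^sub>F n::nat in sequentially. False"
    by eventually_elim auto
  then show False by simp
qed

text \<open>A lower limit is at most any bound that holds eventually along one sequence running
  through the filter. The bound on the quotient is stated with the denominator cleared, so that
  applications need no division in \<open>ereal\<close>.\<close>

lemma dini_hadamard_deriv_le:
  assumes "\<And>k. 0 < t k" "t \<longlonglongrightarrow> 0" "w \<longlonglongrightarrow> u"
    and "\<psi> x = ereal a"
    and "\<forall>\<^sub>F k in sequentially. \<psi> (x + t k *\<^sub>R w k) \<le> ereal (a + c * t k)"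
  shows "dini_hadamard_deriv \<psi> x u \<le> ereal c"
  unfolding dini_hadamard_deriv_def
proof (rule Liminf_le_along_sequence)
  have "filterlim t (at_right 0) sequentially"
    using assms(1,2) by (intro tendsto_imp_filterlim_at_right always_eventually) auto
  then show "filterlim (\<lambda>k. (t k, w k)) (at_right 0 \<times>\<^sub>F nhds u) sequentially"
    using assms(3) by (rule filterlim_Pair)
  show "\<forall>\<^sub>F k in sequentially. (case (t k, w k) of (t, w) \<Rightarrow> (\<psi> (x + t *\<^sub>R w) - \<psi> x) / ereal t)
      \<le> ereal c"
    using assms(5)
  proof eventually_elim
    case (elim k)
    then show ?case
      using assms(1)[of k] assms(4)
      by (cases "\<psi> (x + t k *\<^sub>R w k)") (auto simp: field_simps)
  qed
qed

text \<open>A lower limit below \<open>c\<close> means that quotients below \<open>c\<close> occur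
  frequently. Choosing one such pair in each box of size \<open>inverse (Suc k)\<close> around
  \<open>(0, u)\<close> turns this into a sequence.\<close>

lemma dini_hadamard_deriv_less_sequence:
  assumes "dini_hadamard_deriv \<psi> x u < ereal c"
  obtains t w where "\<And>k. 0 < t k" "t \<longlonglongrightarrow> 0" "w \<longlonglongrightarrow> u"
    "\<And>k. (\<psi> (x + t k *\<^sub>R w k) - \<psi> x) / ereal (t k) < ereal c"
proof -
  let ?F = "at_right (0::real) \<times>\<^sub>F nhds u"
  let ?q = "\<lambda>(t, w). (\<psi> (x + t *\<^sub>R w) - \<psi> x) / ereal t"
  have "\<not> (\<forall>\<^sub>F p in ?F. ereal c \<le> ?q p)"
    using assms Liminf_bounded[of "ereal c" ?q ?F]
    unfolding dini_hadamard_deriv_def by (auto simp: not_le)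
  then have fr: "\<exists>\<^sub>F p in ?F. ?q p < ereal c"
    by (simp add: frequently_def not_less)
  have "\<exists>p. (0 < fst p \<and> fst p < inverse (Suc k) \<and> dist (snd p) u < inverse (Suc k))
      \<and> ?q p < ereal c" for k
  proof -
    have "\<forall>\<^sub>F t in at_right (0::real). 0 < t \<and> t < inverse (Suc k)"
      by (auto simp: eventually_at_right_field intro!: exI[of _ "inverse (real (Suc k))"])
    moreover have "\<forall>\<^sub>F w in nhds u. dist w u < inverse (Suc k)"
      by (intro eventually_nhds_metric[THEN iffD2] exI[of _ "inverse (real (Suc k))"]) auto
    ultimately have "\<forall>\<^sub>F p in ?F. (0 < fst p \<and> fst p < inverse (Suc k))
        \<and> dist (snd p) u < inverse (Suc k)"
      unfolding eventually_prod_filter by (intro exI conjI) auto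
    from frequently_eventually_conj[OF fr this] show ?thesis
      using frequently_ex by fast
  qed
  then have "\<exists>p. \<forall>k. (0 < fst (p k) \<and> fst (p k) < inverse (Suc k)
      \<and> dist (snd (p k)) u < inverse (Suc k)) \<and> ?q (p k) < ereal c"
    by (intro choice allI)
  then obtain p where "\<forall>k. (0 < fst (p k) \<and> fst (p k) < inverse (Suc k)
      \<and> dist (snd (p k)) u < inverse (Suc k)) \<and> ?q (p k) < ereal c" ..
  then have p: "0 < fst (p k)" "fst (p k) < inverse (Suc k)"
    "dist (snd (p k)) u < inverse (Suc k)" "?q (p k) < ereal c" for k
    by blast+
  show thesis
  proof (rule that[of "fst \<circ> p" "snd \<circ> p"])
    show "(fst \<circ> p) \<longlonglongrightarrow> 0"
      using p(1,2)
      by (intro tendsto_sandwich[OF _ _ tendsto_const LIMSEQ_inverse_real_of_nat])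
         (auto intro!: always_eventually less_imp_le)
    have "(\<lambda>k. dist (snd (p k)) u) \<longlonglongrightarrow> 0"
      using p(3)
      by (intro tendsto_sandwich[OF _ _ tendsto_const LIMSEQ_inverse_real_of_nat])
         (auto intro!: always_eventually less_imp_le)
    then show "(snd \<circ> p) \<longlonglongrightarrow> u"
      by (subst tendsto_dist_iff) (simp add: o_def)
  qed (use p in \<open>auto simp: case_prod_beta\<close>)
qed

theorem theorem3p11:
  fixes \<Omega> :: "'a::real_normed_vector set" and v xb xt :: 'a and T :: "'a \<Rightarrow> ereal"
  assumes "\<Omega> \<noteq> {}" and "closed \<Omega>" and "v \<noteq> 0"
    and "T = minimal_time \<Omega> v"
    and "xb \<in> effective_domain T - \<Omega>"
    and "xt = xb + real_of_ereal (T xb) *\<^sub>R v"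
  shows "dini_hadamard_subdiff T xb
           \<subseteq> {x'. blinfun_apply x' (- v) = 1} \<inter> dini_hadamard_normal_cone xt \<Omega> \<and>
         (lower_calm_at T xb \<longrightarrow>
           {x'. blinfun_apply x' (- v) = 1} \<inter> dini_hadamard_normal_cone xt \<Omega>
             \<subseteq> dini_hadamard_subdiff T xb)"
proof (intro conjI impI subsetI)
  have "minimal_time \<Omega> v xb < \<infinity>"
    using assms(4,5) by (simp add: effective_domain_def)
  from minimal_time_attained[OF assms(2) this] obtain r where r: "0 \<le> r" "T xb = ereal r" "xb + r *\<^sub>R v \<in> \<Omega>"
    using assms(4) by metis
  have xt: "xt = xb + r *\<^sub>R v" "xt \<in> \<Omega>"
    using assms(6) r by simp_all
  \<comment> \<open>This is where \<open>xb\<close> lying outside \<open>\<Omega>\<close> enters: it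
    leaves room to move a little along \<open>v\<close> before reaching \<open>xt\<close>.\<close>
  have "r > 0"
    using r assms(5) by (cases "r = 0") auto
  have T_le: "T x \<le> ereal s" if "0 \<le> s" "x + s *\<^sub>R v \<in> \<Omega>" for x s
    using minimal_time_le[OF that] assms(4) by simp
  {
    fix x' assume "x' \<in> dini_hadamard_subdiff T xb"
    then have sub: "ereal (blinfun_apply x' h) \<le> dini_hadamard_deriv T xb h" for h
      by (simp add: dini_hadamard_subdiff_def)
    have bound: "blinfun_apply x' u \<le> c"
      if "\<And>k. 0 < t k" "t \<longlonglongrightarrow> 0" "w \<longlonglongrightarrow> u"
        "\<forall>\<^sub>F k in sequentially. T (xb + t k *\<^sub>R w k) \<le> ereal (r + c * t k)" for u c t w
      using order_trans[OF sub dini_hadamard_deriv_le[OF that(1,2,3) r(2) that(4)]] by simp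
    let ?t = "\<lambda>k. inverse (real (Suc k))"
    have t0: "?t \<longlonglongrightarrow> 0"
      by (rule LIMSEQ_inverse_real_of_nat)
    \<comment> \<open>After a move by \<open>?t k\<close> along \<open>v\<close>, the point
      \<open>xt\<close> is still ahead at time \<open>r - ?t k\<close>, which is nonnegative only
      once \<open>?t k < r\<close>.\<close>
    have "blinfun_apply x' v \<le> - 1"
    proof (rule bound[OF _ t0 tendsto_const])
      have "\<forall>\<^sub>F k in sequentially. ?t k < r"
        using order_tendstoD(2)[OF t0 \<open>r > 0\<close>] .
      then show "\<forall>\<^sub>F k in sequentially. T (xb + ?t k *\<^sub>R v) \<le> ereal (r + - 1 * ?t k)"
        by eventually_elim (intro T_le, use xt in \<open>auto simp: algebra_simps\<close>)
    qed simp
    \<comment> \<open>Moving backwards only adds to the time, so \<open>xt\<close> is reached at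
      \<open>r + ?t k\<close> for every \<open>k\<close>.\<close>
    moreover have "blinfun_apply x' (- v) \<le> 1"
    proof (rule bound[OF _ t0 tendsto_const])
      show "\<forall>\<^sub>F k in sequentially. T (xb + ?t k *\<^sub>R - v) \<le> ereal (r + 1 * ?t k)"
        using r(1) xt by (intro always_eventually allI T_le) (auto simp: algebra_simps)
    qed simp
    ultimately have "blinfun_apply x' (- v) = 1"
      by (simp add: blinfun.minus_right)
    \<comment> \<open>From \<open>xb + t k *\<^sub>R e k\<close> the time \<open>r\<close> leads to
      \<open>xt + t k *\<^sub>R e k\<close>, a point of \<open>\<Omega>\<close>; so \<open>T\<close>
      does not exceed \<open>r\<close> there.\<close>
    moreover have "blinfun_apply x' d \<le> 0" if d: "d \<in> contingent_cone xt \<Omega>" for d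
    proof -
      obtain t e where te: "\<And>k. 0 < t k" "t \<longlonglongrightarrow> 0" "e \<longlonglongrightarrow> d" "\<And>k. xt + t k *\<^sub>R e k \<in> \<Omega>"
        using d unfolding contingent_cone_def by blast
      have "T (xb + t k *\<^sub>R e k) \<le> ereal (r + 0 * t k)" for k
        using r(1) te(4)[of k] by (intro T_le) (auto simp: xt(1) algebra_simps)
      then show ?thesis
        by (intro bound[OF te(1-3)] always_eventually) auto
    qed
    ultimately show "x' \<in> {x'. blinfun_apply x' (- v) = 1} \<inter> dini_hadamard_normal_cone xt \<Omega>"
      by (simp add: dini_hadamard_normal_cone_def)
  }
  fix x' assume calm: "lower_calm_at T xb"
    and x': "x' \<in> {x'. blinfun_apply x' (- v) = 1} \<inter> dini_hadamard_normal_cone xt \<Omega>"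
  obtain l \<delta> where l: "0 < \<delta>"
    "\<And>x. norm (x - xb) \<le> \<delta> \<Longrightarrow> ereal (l * norm (x - xb)) \<le> T x - T xb"
    using calm unfolding lower_calm_at_def by blast
  have "ereal (blinfun_apply x' h) \<le> dini_hadamard_deriv T xb h" for h
  proof (rule ccontr)
    assume "\<not> ?thesis"
    then obtain c where c: "dini_hadamard_deriv T xb h < ereal c" "c < blinfun_apply x' h"
      using ereal_dense2[of "dini_hadamard_deriv T xb h" "ereal (blinfun_apply x' h)"]
      by (auto simp: not_le)
    obtain t w where tw: "\<And>k. 0 < t k" "t \<longlonglongrightarrow> 0" "w \<longlonglongrightarrow> h"
      "\<And>k. (T (xb + t k *\<^sub>R w k) - T xb) / ereal (t k) < ereal c"
      using dini_hadamard_deriv_less_sequence[OF c(1)] by metis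
    \<comment> \<open>The witness \<open>s\<close> is the difference quotient itself; an infinite
      value of \<open>T\<close> would make the quotient infinite, so the infimum is attained and its
      endpoint lies in \<open>\<Omega>\<close>.\<close>
    have "\<exists>s\<le>c. T (xb + t k *\<^sub>R w k) = ereal (r + t k * s) \<and> xt + t k *\<^sub>R (w k + s *\<^sub>R v) \<in> \<Omega>" for k
    proof -
      have "T (xb + t k *\<^sub>R w k) < \<infinity>"
        using tw(4)[of k] tw(1)[of k] r(2) by (cases "T (xb + t k *\<^sub>R w k)") auto
      from minimal_time_attained[OF assms(2) this[unfolded assms(4)]] obtain q
        where q: "T (xb + t k *\<^sub>R w k) = ereal q" "xb + t k *\<^sub>R w k + q *\<^sub>R v \<in> \<Omega>"
        using assms(4) by metis
      define s where "s = (q - r) / t k"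
      have qs: "q = r + t k * s"
        using tw(1)[of k] by (simp add: s_def)
      have "s \<le> c"
        using tw(4)[of k] tw(1)[of k] q(1) r(2) by (simp add: s_def)
      moreover have "xt + t k *\<^sub>R (w k + s *\<^sub>R v) = xb + t k *\<^sub>R w k + q *\<^sub>R v"
        by (simp add: xt(1) qs algebra_simps)
      ultimately show ?thesis
        using q qs by auto
    qed
    then obtain s where s: "\<And>k. s k \<le> c" "\<And>k. T (xb + t k *\<^sub>R w k) = ereal (r + t k * s k)"
      "\<And>k. xt + t k *\<^sub>R (w k + s k *\<^sub>R v) \<in> \<Omega>"
      by metis
    have "(\<lambda>k. norm (t k *\<^sub>R w k)) \<longlonglongrightarrow> 0"
      using tendsto_norm[OF tendsto_scaleR[OF tw(2,3)]] by simp
    then have "\<forall>\<^sub>F k in sequentially. norm (t k *\<^sub>R w k) < \<delta>"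
      using l(1) by (rule order_tendstoD)
    \<comment> \<open>Lower calmness at \<open>xb + t k *\<^sub>R w k\<close>, divided by
      \<open>t k > 0\<close>.\<close>
    then have "\<forall>\<^sub>F k in sequentially. l * norm (w k) \<le> s k"
    proof eventually_elim
      case (elim k)
      then have "l * (t k * norm (w k)) \<le> t k * s k"
        using l(2)[of "xb + t k *\<^sub>R w k"] s(2)[of k] r(2) tw(1)[of k] by simp
      then have "t k * (l * norm (w k)) \<le> t k * s k"
        by (simp add: ac_simps)
      then show ?case
        using tw(1)[of k] by (simp add: mult_le_cancel_left)
    qed
    moreover have "(\<lambda>k. l * norm (w k)) \<longlonglongrightarrow> l * norm h"
      by (intro tendsto_intros tw(3))
    then have "\<forall>\<^sub>F k in sequentially. l * norm h - 1 < l * norm (w k)"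
      by (rule order_tendstoD) simp
    ultimately have "\<forall>\<^sub>F k in sequentially. s k \<in> {l * norm h - 1..c}"
      by eventually_elim (use s(1) in auto)
    then obtain N where N: "\<And>k. k \<ge> N \<Longrightarrow> s k \<in> {l * norm h - 1..c}"
      unfolding eventually_sequentially by blast
    \<comment> \<open>The shift by \<open>N\<close> puts every term in one compact interval, as
      sequential compactness requires; \<open>\<sigma>\<close> then combines the shift with the
      extracted subsequence.\<close>
    have "\<forall>k. s (k + N) \<in> {l * norm h - 1..c}"
      using N by simp
    then obtain m \<rho> where m: "m \<in> {l * norm h - 1..c}" "strict_mono \<rho>"
      "((\<lambda>k. s (k + N)) \<circ> \<rho>) \<longlonglongrightarrow> m"
      by (rule seq_compactE[OF compact_imp_seq_compact[OF compact_Icc]])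
    define \<sigma> where "\<sigma> = (\<lambda>k. \<rho> k + N)"
    have "strict_mono \<sigma>"
      using m(2) by (simp add: \<sigma>_def strict_mono_def)
    have "h + m *\<^sub>R v \<in> contingent_cone xt \<Omega>"
      unfolding contingent_cone_def
    proof (intro CollectI exI conjI allI)
      show "0 < (t \<circ> \<sigma>) k" for k
        using tw(1) by simp
      show "(t \<circ> \<sigma>) \<longlonglongrightarrow> 0"
        using tw(2) \<open>strict_mono \<sigma>\<close> by (rule LIMSEQ_subseq_LIMSEQ)
      have "(\<lambda>k. w (\<sigma> k)) \<longlonglongrightarrow> h"
        using LIMSEQ_subseq_LIMSEQ[OF tw(3) \<open>strict_mono \<sigma>\<close>] by (simp add: o_def)
      moreover have "(\<lambda>k. s (\<sigma> k)) \<longlonglongrightarrow> m"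
        using m(3) by (simp add: o_def \<sigma>_def)
      ultimately show "(\<lambda>k. w (\<sigma> k) + s (\<sigma> k) *\<^sub>R v) \<longlonglongrightarrow> h + m *\<^sub>R v"
        by (intro tendsto_intros)
      show "xt + (t \<circ> \<sigma>) k *\<^sub>R (w (\<sigma> k) + s (\<sigma> k) *\<^sub>R v) \<in> \<Omega>" for k
        using s(3) by simp
    qed
    then have "blinfun_apply x' (h + m *\<^sub>R v) \<le> 0"
      using x' by (simp add: dini_hadamard_normal_cone_def)
    moreover have "blinfun_apply x' v = - 1"
      using x' by (simp add: blinfun.minus_right)
    \<comment> \<open>Since \<open>x'\<close> takes the value \<open>- 1\<close> at
      \<open>v\<close>, the normal cone inequality becomes a bound by \<open>m\<close>, and
      \<open>m \<le> c\<close> contradicts the choice of \<open>c\<close>.\<close>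
    ultimately have "blinfun_apply x' h \<le> m"
      by (simp add: blinfun.add_right blinfun.scaleR_right)
    with m(1) c(2) show False by simp
  qed
  then show "x' \<in> dini_hadamard_subdiff T xb"
    by (simp add: dini_hadamard_subdiff_def)
qed

end
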